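(* The optimization problem $\min_{w\in\mathbb R^d}\sup_{\mathbb P\in\mathcal P_{\rho,\kappa}}\mathbb E^{\mathbb P}[g(b\,a^Tw)]$ (where $(a,b)\sim\mathbb P$) is equivalent to $$\begin{aligned}\min_{w,\lambda,u,v,s,t}\quad&\rho\lambda+\frac1n\sum_{i=1}^ns_i\\ \text{s.t.}\quad&u_i=b_ia_i^Tw,\quad i\in[n],\\&v_i=-u_i,\quad i\in[n],\\&t_i=2\kappa\lambda+s_i,\quad i\in[n],\\&g(u_i)\le s_i,\quad i\in[n],\\&g(v_i)\le t_i,\quad i\in[n],\\&\|w\|_*\le\lambda/M,\end{aligned}$$ where $w\in\mathbb R^d$, $\lambda\in\mathbb R$, and $u,v,s,t\in\mathbb R^n$.
   Context: $g:\mathbb R\to\mathbb R$ is a convex loss function with convex conjugate $g^*(\theta)=\sup_{x\in\mathbb R}\{\theta x-g(x)\}$, and it is assumed that $M=\sup_{\theta\in\mathrm{dom}(g^* )}|\theta|$ is a (finite) real number, with $M>0$ so that $\lambda/M$ makes sense. $(a_1,b_1),\dots,(a_n,b_n)\in\Theta:=\mathbb R^d\times\{1,-1\}$ are given samples and $\mathbb Q=\frac1n\sum_{i=1}^n\delta_{(a_i,b_i)}$ is the empirical distribution. $\|\cdot\|$ is a general norm on $\mathbb R^d$ with dual norm $\|\cdot\|_*$, $\kappa>0$, and the cost on $\Theta\times\Theta$ is $\zeta((a,b),(a',b'))=\|a-a'\|+\kappa|b-b'|$. For probability distributions $\mu,\nu$ on $\Theta$, $W(\mu,\nu)=\inf_{\pi\in\Pi(\mu,\nu)}\int_{\Theta\times\Theta}\zeta(\xi,\xi')\,\pi(d\xi,d\xi')$,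 where $\Pi(\mu,\nu)$ is the set of joint distributions (couplings) of $\mu$ and $\nu$. The ambiguity set is $\mathcal P_{\rho,\kappa}=\{\mathbb P:W(\mathbb P,\mathbb Q)\le\rho\}$, where $\mathbb P$ ranges over distributions on $\Theta$ and $\rho$ is the radius. Equivalence means that the two minimization problems (over $w$, respectively over $w$ and the auxiliary variables) have the same optimal value. *)

theory Defs
  imports "HOL-Probability.Probability"
begin

definition is_norm :: "('a::real_vector \<Rightarrow> real) \<Rightarrow> bool" where
  "is_norm N \<longleftrightarrow>
     (\<forall>x. 0 \<le> N x) \<and> (\<forall>x. N x = 0 \<longleftrightarrow> x = 0) \<and>
     (\<forall>c x. N (c *\<^sub>R x) = \<bar>c\<bar> * N x) \<and> (\<forall>x y. N (x + y) \<le> N x + N y)"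

text \<open>The real supremum is meaningful when \<open>N\<close> is a norm: its unit ball is then nonempty and
  bounded, since all norms on a finite-dimensional space are equivalent.\<close>
definition dual_norm :: "('a::euclidean_space \<Rightarrow> real) \<Rightarrow> 'a \<Rightarrow> real" where
  "dual_norm N w = (SUP x\<in>{x. N x \<le> 1}. x \<bullet> w)"

definition conjugate :: "(real \<Rightarrow> real) \<Rightarrow> real \<Rightarrow> ereal" where
  "conjugate g \<theta> = (SUP x. ereal (\<theta> * x - g x))"

definition conjugate_dom :: "(real \<Rightarrow> real) \<Rightarrow> real set" where
  "conjugate_dom g = {\<theta>. conjugate g \<theta> < \<infinity>}"

definition Theta :: "('a::euclidean_space \<times> real) measure" where
  "Theta = restrict_space borel (UNIV \<times> {1, -1})"

definition distributions :: "('a::euclidean_space \<times> real) measure set" where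
  "distributions = {P. prob_space P \<and> sets P = sets Theta}"

definition empirical :: "('n::finite \<Rightarrow> 'a::euclidean_space \<times> real) \<Rightarrow> ('a \<times> real) measure" where
  "empirical \<xi> = measure_of (space Theta) (sets Theta)
     (\<lambda>A. (\<Sum>i\<in>UNIV. emeasure (return Theta (\<xi> i)) A) / of_nat CARD('n))"

definition cost :: "('a \<Rightarrow> real) \<Rightarrow> real \<Rightarrow> 'a::euclidean_space \<times> real \<Rightarrow> 'a \<times> real \<Rightarrow> real" where
  "cost N \<kappa> \<xi> \<xi>' = N (fst \<xi> - fst \<xi>') + \<kappa> * \<bar>snd \<xi> - snd \<xi>'\<bar>"

definition couplings :: "'a measure \<Rightarrow> 'b measure \<Rightarrow> ('a \<times> 'b) measure set" where
  "couplings \<mu> \<nu> = {\<pi>. prob_space \<pi> \<and> sets \<pi> = sets (\<mu> \<Otimes>\<^sub>M \<nu>) \<and>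
                        distr \<pi> \<mu> fst = \<mu> \<and> distr \<pi> \<nu> snd = \<nu>}"

definition wasserstein :: "('a \<Rightarrow> 'a \<Rightarrow> real) \<Rightarrow> 'a measure \<Rightarrow> 'a measure \<Rightarrow> ennreal" where
  "wasserstein c \<mu> \<nu> = (INF \<pi>\<in>couplings \<mu> \<nu>. \<integral>\<^sup>+ z. ennreal (c (fst z) (snd z)) \<partial>\<pi>)"

definition ambiguity_set ::
  "('a::euclidean_space \<Rightarrow> real) \<Rightarrow> real \<Rightarrow> real \<Rightarrow> ('n::finite \<Rightarrow> 'a \<times> real) \<Rightarrow> ('a \<times> real) measure set" where
  "ambiguity_set N \<kappa> \<rho> \<xi> =
     {P \<in> distributions. wasserstein (cost N \<kappa>) P (empirical \<xi>) \<le> ennreal \<rho>}"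

text \<open>If the domain of the conjugate of the convex function \<open>g\<close> is bounded by \<open>M\<close>, then \<open>g\<close> is
  \<open>M\<close>-Lipschitz; and a distribution at finite transport cost from an empirical one has a finite
  first moment. So under these assumptions the integrand is integrable for every distribution of
  an ambiguity set, and the Bochner integral never takes its default value.\<close>
definition expected_loss ::
  "(real \<Rightarrow> real) \<Rightarrow> 'a::euclidean_space \<Rightarrow> ('a \<times> real) measure \<Rightarrow> real" where
  "expected_loss g w P = (\<integral>(a, b). g (b * (a \<bullet> w)) \<partial>P)"

text \<open>The set function defining \<open>empirical\<close> is a measure, so that \<open>measure_of\<close> does not
  fall back to the null measure.\<close>
lemma space_empirical [simp]: "space (empirical \<xi>) = space Theta"
  and sets_empirical [simp]: "sets (empirical \<xi>) = sets Theta"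
  unfolding empirical_def by (simp_all add: sets.sigma_sets_eq sets.space_closed)

lemma emeasure_empirical:
  fixes \<xi> :: "'n::finite \<Rightarrow> 'a::euclidean_space \<times> real"
  assumes A: "A \<in> sets Theta"
  shows "emeasure (empirical \<xi>) A =
           (\<Sum>i\<in>UNIV. emeasure (return Theta (\<xi> i)) A) / of_nat CARD('n)"
proof (rule emeasure_measure_of[OF empirical_def[of \<xi>]])
  show "countably_additive (sets (empirical \<xi>))
     (\<lambda>A. (\<Sum>i\<in>UNIV. emeasure (return Theta (\<xi> i)) A) / of_nat CARD('n))"
  proof (rule countably_additiveI)
    fix B :: "nat \<Rightarrow> ('a \<times> real) set"
    assume B: "range B \<subseteq> sets (empirical \<xi>)" "disjoint_family B"
    have "(\<Sum>j. (\<Sum>i\<in>UNIV. emeasure (return Theta (\<xi> i)) (B j)) / of_nat CARD('n))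
        = (\<Sum>i\<in>UNIV. \<Sum>j. emeasure (return Theta (\<xi> i)) (B j)) / of_nat CARD('n)"
      by (simp add: divide_ennreal_def suminf_sum)
    also have "\<dots> = (\<Sum>i\<in>UNIV. emeasure (return Theta (\<xi> i)) (\<Union>j. B j)) / of_nat CARD('n)"
      using B by (subst suminf_emeasure) auto
    finally show "(\<Sum>j. (\<Sum>i\<in>UNIV. emeasure (return Theta (\<xi> i)) (B j)) / of_nat CARD('n))
        = (\<Sum>i\<in>UNIV. emeasure (return Theta (\<xi> i)) (\<Union>j. B j)) / of_nat CARD('n)" .
  qed
qed (use A in \<open>auto simp: positive_def dest: sets.sets_into_space\<close>)

end

theory Submission
  imports Defs
begin

text \<open>For fixed \<open>w\<close>, both sides are the value of a transport problem and of its Lagrangian dual in the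
  multiplier \<open>l\<close> of the constraint that the transport cost be at most \<open>\<rho>\<close>.

  Weak duality (\<open>expected_loss_le_dual\<close>). Subgradients of \<open>g\<close> lie in the domain of its conjugate, so
  \<open>g\<close> is \<open>M\<close>-Lipschitz (\<open>convex_lipschitz_of_conjugate_dom\<close>), and the loss changes with the feature
  vector at rate at most \<open>M * dual_norm nrm w\<close>. Hence, if \<open>l\<close> is at least this rate, the loss minus
  \<open>l\<close> times the cost of getting there from sample \<open>i\<close> is largest at the sample itself or at the
  sample with its label flipped, with value \<open>max (g (u i)) (g (- u i) - 2 * \<kappa> * l)\<close>. Integrating
  against an almost optimal coupling bounds the expected loss by the objective of the program.

  Strong duality (\<open>dual_bound_attained\<close>). An adversary has two means of using the budget. Flipping
  the label of a sample earns a fixed gain for the cost \<open>2 * \<kappa>\<close>, up to the mass of that sample.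
  Sending a vanishing fraction of the mass to infinity earns \<open>M * dual_norm nrm w\<close> per unit of
  cost, in the limit and without restriction, because \<open>g\<close> lies above lines of slope arbitrarily
  close to \<open>M\<close> in absolute value (\<open>escape_le_expected_loss_bound\<close>). The best mixture is a fractional
  knapsack, solved greedily (\<open>fractional_knapsack_threshold\<close>), and its marginal price is a
  multiplier \<open>l\<close> at which the dual objective equals the limiting loss of the adversary.

  Taking for each \<open>s i\<close> the least feasible value and then the infimum over \<open>w\<close> gives the theorem.\<close>

section \<open>Norms and dual norms\<close>

lemma is_normD:
  assumes "is_norm N"
  shows is_norm_nonneg: "0 \<le> N x"
    and is_norm_eq_0_iff: "N x = 0 \<longleftrightarrow> x = 0"
    and is_norm_scaleR: "N (c *\<^sub>R x) = \<bar>c\<bar> * N x"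
    and is_norm_triangle: "N (x + y) \<le> N x + N y"
  using assms by (auto simp: is_norm_def)

lemma is_norm_sum_le:
  assumes "is_norm N" "finite A"
  shows "N (\<Sum>i\<in>A. f i) \<le> (\<Sum>i\<in>A. N (f i))"
  using assms(2)
proof (induction A rule: finite_induct)
  case empty
  then show ?case using is_norm_eq_0_iff[OF assms(1), of 0] by simp
next
  case (insert i A)
  then show ?case using is_norm_triangle[OF assms(1), of "f i" "\<Sum>i\<in>A. f i"] by simp
qed

lemma is_norm_le_norm:
  fixes N :: "'a::euclidean_space \<Rightarrow> real"
  assumes "is_norm N"
  shows "N x \<le> (\<Sum>e\<in>Basis. N e) * norm x"
proof -
  have "N x = N (\<Sum>e\<in>Basis. (x \<bullet> e) *\<^sub>R e)"
    by (simp add: euclidean_representation)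
  also have "\<dots> \<le> (\<Sum>e\<in>Basis. N ((x \<bullet> e) *\<^sub>R e))"
    by (rule is_norm_sum_le[OF assms]) simp
  also have "\<dots> \<le> (\<Sum>e\<in>Basis. N e * norm x)"
    by (intro sum_mono) (auto simp: is_norm_scaleR[OF assms] mult.commute[of _ "N _"]
        intro!: mult_left_mono Basis_le_norm is_norm_nonneg[OF assms])
  finally show ?thesis by (simp add: sum_distrib_right)
qed

lemma is_norm_continuous:
  fixes N :: "'a::euclidean_space \<Rightarrow> real"
  assumes "is_norm N"
  shows "continuous_on UNIV N"
proof (rule lipschitz_on_continuous_on)
  show "(\<Sum>e\<in>Basis. N e)-lipschitz_on UNIV N"
  proof (rule lipschitz_onI)
    fix x y :: 'a
    have "N x \<le> N (x - y) + N y" for x y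
      using is_norm_triangle[OF assms, of "x - y" y] by simp
    moreover have "N (y - x) = N (x - y)"
      using is_norm_scaleR[OF assms, of "-1" "x - y"] by simp
    ultimately have "\<bar>N x - N y\<bar> \<le> N (x - y)"
      by (smt (verit))
    also have "\<dots> \<le> (\<Sum>e\<in>Basis. N e) * norm (x - y)"
      by (rule is_norm_le_norm[OF assms])
    finally show "dist (N x) (N y) \<le> (\<Sum>e\<in>Basis. N e) * dist x y"
      by (simp add: dist_norm)
  qed (auto intro: sum_nonneg is_norm_nonneg[OF assms])
qed

text \<open>Compactness of the Euclidean unit sphere is what makes the supremum in the dual norm
  finite.\<close>
lemma norm_le_is_norm:
  fixes N :: "'a::euclidean_space \<Rightarrow> real"
  assumes "is_norm N"
  obtains c where "c > 0" "\<And>x. c * norm x \<le> N x"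
proof -
  have "sphere (0::'a) 1 \<noteq> {}" by simp
  then obtain z :: 'a where z: "norm z = 1" "\<And>x. norm x = 1 \<Longrightarrow> N z \<le> N x"
    using continuous_attains_inf[of "sphere (0::'a) 1" N]
      continuous_on_subset[OF is_norm_continuous[OF assms]] by auto
  have "N z * norm x \<le> N x" for x
  proof (cases "x = 0")
    case True
    then show ?thesis by (simp add: is_norm_nonneg[OF assms])
  next
    case False
    then have "N z \<le> N ((1 / norm x) *\<^sub>R x)" by (intro z(2)) simp
    then show ?thesis using False by (simp add: is_norm_scaleR[OF assms] field_simps)
  qed
  moreover have "N z > 0"
    using z(1) is_norm_nonneg[OF assms, of z] is_norm_eq_0_iff[OF assms, of z] by fastforce
  ultimately show ?thesis using that by blast
qed

lemma inner_le_dual_norm: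
  fixes N :: "'a::euclidean_space \<Rightarrow> real"
  assumes "is_norm N" "N x \<le> 1"
  shows "x \<bullet> w \<le> dual_norm N w"
proof -
  obtain c where c: "c > 0" "\<And>x. c * norm x \<le> N x"
    using norm_le_is_norm[OF assms(1)] by blast
  have "y \<bullet> w \<le> norm w / c" if "N y \<le> 1" for y
  proof -
    have "norm y \<le> 1 / c" using c(1) c(2)[of y] that by (simp add: field_simps)
    then have "norm y * norm w \<le> 1 / c * norm w" by (rule mult_right_mono) simp
    then show ?thesis using norm_cauchy_schwarz[of y w] by simp
  qed
  then have "bdd_above ((\<lambda>x. x \<bullet> w) ` {x. N x \<le> 1})" by (intro bdd_aboveI2) auto
  then show ?thesis unfolding dual_norm_def using assms(2) by (intro cSUP_upper) auto
qed

lemma dual_norm_nonneg: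
  fixes N :: "'a::euclidean_space \<Rightarrow> real"
  assumes "is_norm N"
  shows "0 \<le> dual_norm N w"
  using inner_le_dual_norm[OF assms, of 0 w] is_norm_eq_0_iff[OF assms, of 0] by simp

lemma dual_norm_le:
  fixes N :: "'a::euclidean_space \<Rightarrow> real"
  assumes "is_norm N" "\<And>x. N x \<le> 1 \<Longrightarrow> x \<bullet> w \<le> B"
  shows "dual_norm N w \<le> B"
  unfolding dual_norm_def
proof (rule cSUP_least)
  show "{x. N x \<le> 1} \<noteq> {}" using is_norm_eq_0_iff[OF assms(1), of 0] by (auto intro: exI[of _ 0])
qed (use assms in auto)

lemma abs_inner_le_dual_norm:
  fixes N :: "'a::euclidean_space \<Rightarrow> real"
  assumes "is_norm N"
  shows "\<bar>x \<bullet> w\<bar> \<le> N x * dual_norm N w"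
proof (cases "x = 0")
  case True
  then show ?thesis using is_norm_eq_0_iff[OF assms, of 0] by simp
next
  case False
  then have Nx: "N x > 0"
    using is_norm_nonneg[OF assms, of x] is_norm_eq_0_iff[OF assms, of x] by linarith
  have "s * (x \<bullet> w) \<le> N x * dual_norm N w" if "\<bar>s\<bar> = 1" for s
  proof -
    have "((s / N x) *\<^sub>R x) \<bullet> w \<le> dual_norm N w"
      by (rule inner_le_dual_norm[OF assms]) (use Nx that in \<open>simp add: is_norm_scaleR[OF assms]\<close>)
    then show ?thesis using Nx by (simp add: field_simps)
  qed
  from this[of 1] this[of "-1"] show ?thesis by simp
qed

section \<open>Slopes of a convex function\<close>

text \<open>A slope has finite conjugate exactly when some line of that slope lies below \<open>g\<close>; this is the
  only form in which conjugates enter the proof.\<close>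
lemma conjugate_dom_iff:
  "\<theta> \<in> conjugate_dom g \<longleftrightarrow> (\<exists>c. \<forall>x. \<theta> * x - c \<le> g x)"
proof
  assume "\<theta> \<in> conjugate_dom g"
  then have "conjugate g \<theta> < \<infinity>" by (simp add: conjugate_dom_def)
  then obtain c where c: "conjugate g \<theta> \<le> ereal c"
    by (cases "conjugate g \<theta>") auto
  have "\<theta> * x - c \<le> g x" for x
  proof -
    have "ereal (\<theta> * x - g x) \<le> conjugate g \<theta>" unfolding conjugate_def by (rule SUP_upper) simp
    then have "ereal (\<theta> * x - g x) \<le> ereal c" using c by (rule order_trans)
    then show ?thesis by simp
  qed
  then show "\<exists>c. \<forall>x. \<theta> * x - c \<le> g x" by blast
next
  assume "\<exists>c. \<forall>x. \<theta> * x - c \<le> g x"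
  then obtain c where c: "\<And>x. \<theta> * x - c \<le> g x" by blast
  have "conjugate g \<theta> \<le> ereal c"
    unfolding conjugate_def by (rule SUP_least) (use c in \<open>simp add: algebra_simps\<close>)
  also have "\<dots> < \<infinity>" by simp
  finally show "\<theta> \<in> conjugate_dom g" by (simp add: conjugate_dom_def)
qed

lemma convex_subgradient:
  fixes g :: "real \<Rightarrow> real"
  assumes "convex_on UNIV g"
  obtains \<theta> where "\<theta> \<in> conjugate_dom g" "\<And>y. g x + \<theta> * (y - x) \<le> g y"
proof -
  define \<theta> where "\<theta> = Inf ((\<lambda>t. (g x - g t) / (x - t)) ` ({x<..} \<inter> UNIV))"
  have sub: "g x + \<theta> * (y - x) \<le> g y" for y
    unfolding \<theta>_def using convex_le_Inf_differential[OF assms, of x y] by simp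
  then have "\<forall>y. \<theta> * y - (\<theta> * x - g x) \<le> g y" by (simp add: algebra_simps)
  then have "\<theta> \<in> conjugate_dom g" unfolding conjugate_dom_iff by blast
  with sub show ?thesis using that by blast
qed

text \<open>Every subgradient lies in the domain of the conjugate, so a bound on that domain bounds all
  subgradients, and the subgradient at \<open>x\<close> controls how far \<open>g\<close> can drop from \<open>x\<close> to \<open>y\<close>.\<close>
lemma convex_lipschitz_of_conjugate_dom:
  fixes g :: "real \<Rightarrow> real"
  assumes "convex_on UNIV g" "\<And>\<theta>. \<theta> \<in> conjugate_dom g \<Longrightarrow> \<bar>\<theta>\<bar> \<le> M"
  shows "g x \<le> g y + M * \<bar>x - y\<bar>"
proof -
  obtain \<theta> where \<theta>: "\<theta> \<in> conjugate_dom g" "\<And>y. g x + \<theta> * (y - x) \<le> g y"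
    using convex_subgradient[OF assms(1)] by blast
  have "g x \<le> g y + \<theta> * (x - y)" using \<theta>(2)[of y] by (simp add: algebra_simps)
  also have "\<theta> * (x - y) \<le> \<bar>\<theta>\<bar> * \<bar>x - y\<bar>" by (metis abs_ge_self abs_mult)
  also have "\<dots> \<le> M * \<bar>x - y\<bar>" using assms(2)[OF \<theta>(1)] by (rule mult_right_mono) simp
  finally show ?thesis by simp
qed

lemma
  assumes "ereal M = (SUP \<theta>\<in>conjugate_dom g. ereal \<bar>\<theta>\<bar>)"
  shows Sup_conjugate_dom_upper: "\<theta> \<in> conjugate_dom g \<Longrightarrow> \<bar>\<theta>\<bar> \<le> M"
    and Sup_conjugate_dom_least: "(\<And>\<theta>. \<theta> \<in> conjugate_dom g \<Longrightarrow> \<bar>\<theta>\<bar> \<le> m) \<Longrightarrow> M \<le> m"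
proof -
  show "\<bar>\<theta>\<bar> \<le> M" if "\<theta> \<in> conjugate_dom g"
    using SUP_upper[OF that, of "\<lambda>\<theta>. ereal \<bar>\<theta>\<bar>"] by (simp flip: assms)
  assume "\<And>\<theta>. \<theta> \<in> conjugate_dom g \<Longrightarrow> \<bar>\<theta>\<bar> \<le> m"
  then have "ereal M \<le> ereal m" unfolding assms by (intro SUP_least) simp
  then show "M \<le> m" by simp
qed

section \<open>A fractional knapsack\<close>

text \<open>Duality for a continuous knapsack with unit sizes, values \<open>D i\<close>, capacity \<open>h\<close>, and the option
  of selling unused capacity at price \<open>c\<close>. The greedy choice is optimal: if the items worth more
  than \<open>c\<close> all fit, they are taken, the rest of the capacity is sold, and \<open>l = c\<close>. Otherwise \<open>l\<close> is
  the value of the marginal item: items worth more than \<open>l\<close> are taken entirely, and those worth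
  exactly \<open>l\<close> share the remaining capacity equally. In either case complementary slackness turns
  the primal value (left) into the dual value (right).\<close>
lemma fractional_knapsack_threshold:
  fixes D :: "'n::finite \<Rightarrow> real" and h c :: real
  assumes "h \<ge> 0"
  obtains l \<alpha> where "l \<ge> c" "\<And>i. 0 \<le> \<alpha> i" "\<And>i. \<alpha> i \<le> 1" "(\<Sum>i\<in>UNIV. \<alpha> i) \<le> h"
    "(\<Sum>i\<in>UNIV. \<alpha> i * D i) + c * (h - (\<Sum>i\<in>UNIV. \<alpha> i)) = l * h + (\<Sum>i\<in>UNIV. max 0 (D i - l))"
proof -
  have "\<exists>l\<ge>c. \<exists>\<beta>::real. 0 \<le> \<beta> \<and> \<beta> \<le> 1 \<and> card {i. D i > l} + \<beta> * card {i. D i = l} \<le> h \<and>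
      (l = c \<or> card {i. D i > l} + \<beta> * card {i. D i = l} = h)"
  proof (cases "real (card {i. D i > c}) \<le> h")
    case True
    then show ?thesis by (intro exI[of _ c]) (auto intro!: exI[of _ 0])
  next
    case False
    \<comment> \<open>The marginal item is the most valuable one such that the items at least as valuable
      already fill the knapsack. It beats \<open>c\<close>, and the items strictly above it still fit, because
      otherwise the least valuable of them would be a better candidate.\<close>
    define S where "S = {d \<in> range D. h \<le> card {j. d \<le> D j}}"
    have in_S: "Min (D ` {i. D i > x}) \<in> S" if x: "h < card {i. D i > x}" for x
    proof -
      have ne: "D ` {i. D i > x} \<noteq> {}"
      proof
        assume "D ` {i. D i > x} = {}"
        then have "{i. D i > x} = {}" by blast
        with x assms show False by (metis card.empty not_less of_nat_0)
      qed
      have "Min (D ` {i. D i > x}) \<in> D ` {i. D i > x}" by (rule Min_in[OF _ ne]) simp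
      moreover have "{i. D i > x} \<subseteq> {j. Min (D ` {i. D i > x}) \<le> D j}" by auto
      then have "card {i. D i > x} \<le> card {j. Min (D ` {i. D i > x}) \<le> D j}"
        by (intro card_mono) auto
      ultimately show ?thesis unfolding S_def using x by auto
    qed
    have gt: "Min (D ` {i. D i > x}) > x" if x: "h < card {i. D i > x}" for x
    proof -
      have "{i. D i > x} \<noteq> {}" using x assms by (metis card.empty not_less of_nat_0)
      then show ?thesis by simp
    qed
    have finS: "finite S" unfolding S_def by simp
    define l where "l = Max S"
    have "S \<noteq> {}" using in_S[of c] False by auto
    then have lS: "l \<in> S" unfolding l_def using finS by simp
    have lc: "l > c"
      using gt[of c] in_S[of c] False Max_ge[OF finS, of "Min (D ` {i. D i > c})"]
      unfolding l_def by simp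
    have lower: "card {i. D i > l} \<le> h"
    proof (rule ccontr)
      assume "\<not> ?thesis"
      then have "h < card {i. D i > l}" by simp
      from gt[OF this] Max_ge[OF finS in_S[OF this]] show False unfolding l_def by simp
    qed
    have un: "{j. l \<le> D j} = {i. D i > l} \<union> {i. D i = l}" by auto
    have split: "card {j. l \<le> D j} = card {i. D i > l} + card {i. D i = l}"
      unfolding un by (rule card_Un_disjoint) auto
    have upper: "h \<le> card {i. D i > l} + real (card {i. D i = l})"
      using lS split unfolding S_def by simp
    from lS obtain i where "D i = l" unfolding S_def by auto
    then have pos: "card {i. D i = l} > 0" by (auto simp: card_gt_0_iff)
    define \<beta> where "\<beta> = (h - card {i. D i > l}) / card {i. D i = l}"
    have "0 \<le> \<beta>" "\<beta> \<le> 1"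
      using lower upper pos unfolding \<beta>_def by (auto simp: field_simps)
    moreover have "\<beta> * card {i. D i = l} = h - card {i. D i > l}"
      unfolding \<beta>_def
      by (rule nonzero_eq_divide_eq[THEN iffD1, OF _ refl]) (use pos in linarith)
    ultimately show ?thesis using lc by (intro exI[of _ l]) auto
  qed
  then obtain l and \<beta> :: real where l: "l \<ge> c" "0 \<le> \<beta>" "\<beta> \<le> 1"
    "card {i. D i > l} + \<beta> * card {i. D i = l} \<le> h"
    "l = c \<or> card {i. D i > l} + \<beta> * card {i. D i = l} = h"
    by blast
  define \<alpha> where "\<alpha> i = of_bool (D i > l) + \<beta> * of_bool (D i = l)" for i
  have sum_\<alpha>: "(\<Sum>i\<in>UNIV. \<alpha> i) = card {i. D i > l} + \<beta> * card {i. D i = l}"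
    unfolding \<alpha>_def by (simp add: sum.distrib sum_distrib_left[symmetric])
  have "\<alpha> i * D i = l * \<alpha> i + max 0 (D i - l)" for i
    unfolding \<alpha>_def by (auto simp: algebra_simps)
  then have "(\<Sum>i\<in>UNIV. \<alpha> i * D i) = l * (\<Sum>i\<in>UNIV. \<alpha> i) + (\<Sum>i\<in>UNIV. max 0 (D i - l))"
    by (simp add: sum.distrib sum_distrib_left)
  moreover have "c * (h - (\<Sum>i\<in>UNIV. \<alpha> i)) = l * (h - (\<Sum>i\<in>UNIV. \<alpha> i))"
    using l(5) unfolding sum_\<alpha> by auto
  ultimately have "(\<Sum>i\<in>UNIV. \<alpha> i * D i) + c * (h - (\<Sum>i\<in>UNIV. \<alpha> i))
      = l * h + (\<Sum>i\<in>UNIV. max 0 (D i - l))"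
    by (simp add: algebra_simps)
  moreover have "0 \<le> \<alpha> i" "\<alpha> i \<le> 1" for i using l(2,3) unfolding \<alpha>_def by auto
  moreover have "(\<Sum>i\<in>UNIV. \<alpha> i) \<le> h" using l(4) by (simp only: sum_\<alpha>)
  ultimately show ?thesis by (intro that[of l \<alpha>] l(1))
qed

section \<open>Measures on the sample space\<close>

lemma space_Theta: "space Theta = UNIV \<times> {1, -1}"
  by (simp add: Theta_def space_restrict_space)

lemma measurable_Theta: "f \<in> borel_measurable borel \<Longrightarrow> f \<in> borel_measurable Theta"
  unfolding Theta_def by (rule measurable_restrict_space1)

text \<open>Sampling an index uniformly turns integrals against the empirical distribution into finite
  averages and lets a coupling be built from any relocation rule for the samples.\<close>
lemma empirical_eq_distr:
  fixes \<xi> :: "'n::finite \<Rightarrow> 'a::euclidean_space \<times> real"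
  assumes "\<And>i. \<xi> i \<in> space Theta"
  shows "empirical \<xi> = distr (measure_pmf (pmf_of_set UNIV)) Theta \<xi>"
proof (rule measure_eqI)
  fix A assume "A \<in> sets (empirical \<xi>)"
  then have A: "A \<in> sets Theta" by simp
  have \<xi>: "\<xi> \<in> measurable (measure_pmf (pmf_of_set UNIV)) Theta" using assms by simp
  have "emeasure (distr (measure_pmf (pmf_of_set UNIV)) Theta \<xi>) A
      = (\<integral>\<^sup>+i. indicator A (\<xi> i) \<partial>measure_pmf (pmf_of_set UNIV))"
    using nn_integral_distr[OF \<xi>, of "indicator A"] A by simp
  also have "\<dots> = (\<Sum>i\<in>UNIV. indicator A (\<xi> i)) / of_nat CARD('n)"
    by (subst nn_integral_pmf_of_set) (auto simp: ennreal_of_nat_eq_real_of_nat)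
  finally show "emeasure (empirical \<xi>) A = emeasure (distr (measure_pmf (pmf_of_set UNIV)) Theta \<xi>) A"
    using A assms by (simp add: emeasure_empirical)
qed simp

lemma
  fixes \<xi> :: "'n::finite \<Rightarrow> 'a::euclidean_space \<times> real" and f :: "_ \<Rightarrow> real"
  assumes "\<And>i. \<xi> i \<in> space Theta" "f \<in> borel_measurable Theta"
  shows integrable_empirical: "integrable (empirical \<xi>) f"
    and integral_empirical: "(\<integral>z. f z \<partial>empirical \<xi>) = (\<Sum>i\<in>UNIV. f (\<xi> i)) / CARD('n)"
  using assms
  by (auto simp: empirical_eq_distr integrable_distr_eq integral_distr integral_pmf_of_set
      intro!: integrable_measure_pmf_finite)

lemma
  fixes N :: "'a::euclidean_space \<Rightarrow> real"
  assumes N: "is_norm N"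
  shows cost_measurable: "(\<lambda>z. cost N \<kappa> (fst z) (snd z)) \<in> borel_measurable (Theta \<Otimes>\<^sub>M Theta)"
    and norm_fst_measurable: "(\<lambda>z. N (fst z)) \<in> borel_measurable (Theta :: ('a \<times> real) measure)"
proof -
  have [measurable]: "N \<in> borel_measurable borel"
    by (rule borel_measurable_continuous_onI[OF is_norm_continuous[OF N]])
  have [measurable]: "fst \<in> measurable Theta (borel :: 'a measure)" "snd \<in> measurable Theta (borel :: real measure)"
    unfolding Theta_def
    by (auto intro!: measurable_restrict_space1 borel_measurable_continuous_onI continuous_intros)
  show "(\<lambda>z. cost N \<kappa> (fst z) (snd z)) \<in> borel_measurable (Theta \<Otimes>\<^sub>M Theta)"
    unfolding cost_def by measurable
  show "(\<lambda>z. N (fst z)) \<in> borel_measurable (Theta :: ('a \<times> real) measure)"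
    by measurable
qed

lemma cost_nonneg:
  assumes "is_norm N" "\<kappa> > 0"
  shows "0 \<le> cost N \<kappa> \<xi> \<xi>'"
  using assms by (simp add: cost_def is_norm_nonneg)

lemma loss_measurable:
  fixes w :: "'a::euclidean_space"
  assumes "continuous_on UNIV g"
  shows "(\<lambda>z. g (snd z * (fst z \<bullet> w))) \<in> borel_measurable Theta"
  by (intro measurable_Theta borel_measurable_continuous_onI
      continuous_on_compose2[OF assms] continuous_intros) auto

section \<open>The dual problem bounds the worst case\<close>

text \<open>If \<open>\<xi>\<close> carries the label of \<open>\<xi>'\<close>, the loss grows at rate at most \<open>M\<close> times the dual norm
  of \<open>w\<close>, hence at most \<open>l\<close>, per unit of transport. If the labels differ, the comparison is made
  with the loss at the flipped label, and the surplus cost \<open>2 * \<kappa>\<close> of the flip pays for the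
  reduction in the second argument of the maximum.\<close>
lemma loss_le_transport_cost:
  fixes g :: "real \<Rightarrow> real" and w :: "'a::euclidean_space"
  assumes N: "is_norm N" and M: "M \<ge> 0" and lip: "\<And>x y. g x \<le> g y + M * \<bar>x - y\<bar>"
    and l: "M * dual_norm N w \<le> l"
    and \<xi>: "\<xi> \<in> space Theta" "\<xi>' \<in> space Theta"
  shows "g (snd \<xi> * (fst \<xi> \<bullet> w)) \<le> l * cost N \<kappa> \<xi> \<xi>' +
     max (g (snd \<xi>' * (fst \<xi>' \<bullet> w))) (g (- (snd \<xi>' * (fst \<xi>' \<bullet> w))) - 2 * \<kappa> * l)"
proof -
  obtain a b a' b' where eq: "\<xi> = (a, b)" "\<xi>' = (a', b')" by (cases \<xi>, cases \<xi>')
  have b: "b \<in> {1, -1}" "b' \<in> {1, -1}" using \<xi> by (auto simp: eq space_Theta)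
  have abs_b: "\<bar>b\<bar> = 1" using b by auto
  have "\<bar>b * (a \<bullet> w) - b * (a' \<bullet> w)\<bar> = \<bar>(a - a') \<bullet> w\<bar>"
    by (simp add: right_diff_distrib[symmetric] abs_mult abs_b inner_diff_left)
  also have "\<dots> \<le> N (a - a') * dual_norm N w" by (rule abs_inner_le_dual_norm[OF N])
  finally have "M * \<bar>b * (a \<bullet> w) - b * (a' \<bullet> w)\<bar> \<le> M * (N (a - a') * dual_norm N w)"
    by (rule mult_left_mono[OF _ M])
  also have "\<dots> = N (a - a') * (M * dual_norm N w)" by (simp add: mult_ac)
  also have "\<dots> \<le> N (a - a') * l" by (rule mult_left_mono[OF l is_norm_nonneg[OF N]])
  finally have *: "g (b * (a \<bullet> w)) \<le> g (b * (a' \<bullet> w)) + l * N (a - a')"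
    using lip[of "b * (a \<bullet> w)" "b * (a' \<bullet> w)"] by (simp add: mult.commute)
  show ?thesis
  proof (cases "b = b'")
    case True
    then show ?thesis using * by (simp add: eq cost_def)
  next
    case False
    then have "b = - b'" "\<bar>b - b'\<bar> = 2" using b by auto
    then show ?thesis using * by (simp add: eq cost_def algebra_simps)
  qed
qed

text \<open>Weak duality: the pointwise bound is integrated against a coupling. The slack \<open>\<delta>\<close> above the
  Wasserstein distance provides such a coupling whether or not the infimum is attained.\<close>
lemma expected_loss_le_dual:
  fixes g :: "real \<Rightarrow> real" and w :: "'a::euclidean_space"
    and \<xi> :: "'n::finite \<Rightarrow> 'a \<times> real"
  assumes N: "is_norm N" and \<kappa>: "\<kappa> > 0" and \<rho>: "\<rho> \<ge> 0" and M: "M \<ge> 0"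
    and lip: "\<And>x y. g x \<le> g y + M * \<bar>x - y\<bar>"
    and l: "M * dual_norm N w \<le> l"
    and \<xi>: "\<And>i. \<xi> i \<in> space Theta"
    and P: "P \<in> ambiguity_set N \<kappa> \<rho> \<xi>"
  shows "expected_loss g w P \<le> \<rho> * l + (\<Sum>i\<in>UNIV. max (g (snd (\<xi> i) * (fst (\<xi> i) \<bullet> w)))
           (g (- (snd (\<xi> i) * (fst (\<xi> i) \<bullet> w))) - 2 * \<kappa> * l)) / CARD('n)"
proof -
  have "l \<ge> 0" using l M dual_norm_nonneg[OF N, of w] by (meson mult_nonneg_nonneg order_trans)
  define f where "f z = g (snd z * (fst z \<bullet> w))" for z :: "'a \<times> real"
  define S where "S z = max (g (snd z * (fst z \<bullet> w))) (g (- (snd z * (fst z \<bullet> w))) - 2 * \<kappa> * l)"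
    for z :: "'a \<times> real"
  have g_cont: "continuous_on UNIV g"
  proof (rule lipschitz_on_continuous_on)
    show "M-lipschitz_on UNIV g"
    proof (rule lipschitz_onI)
      show "dist (g x) (g y) \<le> M * dist x y" for x y
        using lip[of x y] lip[of y x] by (simp add: dist_real_def abs_le_iff abs_minus_commute)
    qed (rule M)
  qed
  have f_meas: "f \<in> borel_measurable Theta"
    unfolding f_def by (rule loss_measurable[OF g_cont])
  have S_meas: "S \<in> borel_measurable Theta"
    unfolding S_def
    by (intro measurable_Theta borel_measurable_continuous_onI continuous_on_max
      continuous_on_diff continuous_on_compose2[OF g_cont] continuous_intros) auto
  have P_sets: "sets P = sets Theta" and "prob_space P"
    and W: "wasserstein (cost N \<kappa>) P (empirical \<xi>) \<le> ennreal \<rho>"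
    using P by (auto simp: ambiguity_set_def distributions_def)
  have "expected_loss g w P \<le> \<rho> * l + (\<Sum>i\<in>UNIV. S (\<xi> i)) / CARD('n) + e" if "e > 0" for e
  proof -
    define \<delta> where "\<delta> = e / (l + 1)"
    have \<delta>: "\<delta> > 0" "l * \<delta> \<le> e" using \<open>l \<ge> 0\<close> that by (auto simp: \<delta>_def field_simps)
    have "wasserstein (cost N \<kappa>) P (empirical \<xi>) < ennreal (\<rho> + \<delta>)"
      using W by (rule le_less_trans) (use \<rho> \<delta> in \<open>auto intro: ennreal_lessI\<close>)
    then obtain \<pi> where \<pi>: "\<pi> \<in> couplings P (empirical \<xi>)"
      and \<pi>_cost: "(\<integral>\<^sup>+ z. ennreal (cost N \<kappa> (fst z) (snd z)) \<partial>\<pi>) < ennreal (\<rho> + \<delta>)"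
      unfolding wasserstein_def INF_less_iff by blast
    have prob: "prob_space \<pi>" and dP: "distr \<pi> P fst = P"
      and dQ: "distr \<pi> (empirical \<xi>) snd = empirical \<xi>"
      and "sets \<pi> = sets (P \<Otimes>\<^sub>M empirical \<xi>)"
      using \<pi> by (auto simp: couplings_def)
    interpret prob_space \<pi> by (rule prob)
    have sets_\<pi>: "sets \<pi> = sets (Theta \<Otimes>\<^sub>M Theta)"
      using \<open>sets \<pi> = _\<close> sets_pair_measure_cong[OF P_sets sets_empirical] by simp
    have "space \<pi> = space Theta \<times> space Theta"
      using sets_eq_imp_space_eq[OF sets_\<pi>] by (simp add: space_pair_measure)
    then have sp: "fst z \<in> space Theta" "snd z \<in> space Theta" if "z \<in> space \<pi>" for z
      using that by (simp_all only: mem_Times_iff)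
    have "fst \<in> measurable \<pi> Theta" "snd \<in> measurable \<pi> Theta"
      unfolding measurable_cong_sets[OF sets_\<pi> refl] by (rule measurable_fst measurable_snd)+
    then have fst_meas: "fst \<in> measurable \<pi> P" and snd_meas: "snd \<in> measurable \<pi> (empirical \<xi>)"
      by (simp_all only: measurable_cong_sets[OF refl P_sets] measurable_cong_sets[OF refl sets_empirical])
    have c_meas: "(\<lambda>z. cost N \<kappa> (fst z) (snd z)) \<in> borel_measurable \<pi>"
      using cost_measurable[OF N] measurable_cong_sets[OF sets_\<pi> refl] by blast
    have int_c: "integrable \<pi> (\<lambda>z. cost N \<kappa> (fst z) (snd z))"
      by (rule integrableI_nonneg[OF c_meas])
        (use \<pi>_cost cost_nonneg[OF N \<kappa>] in \<open>auto simp: top.not_eq_extremum intro: less_trans\<close>)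
    have "ennreal (\<integral>z. cost N \<kappa> (fst z) (snd z) \<partial>\<pi>) < ennreal (\<rho> + \<delta>)"
      using \<pi>_cost nn_integral_eq_integral[OF int_c] cost_nonneg[OF N \<kappa>] by simp
    then have c_le: "(\<integral>z. cost N \<kappa> (fst z) (snd z) \<partial>\<pi>) \<le> \<rho> + \<delta>"
      by (meson ennreal_less_iff ennreal_leI leD linorder_le_cases)
    have int_snd: "integrable \<pi> (\<lambda>z. h (snd z))"
      and integral_snd: "(\<integral>z. h (snd z) \<partial>\<pi>) = (\<Sum>i\<in>UNIV. h (\<xi> i)) / CARD('n)"
      if h: "h \<in> borel_measurable Theta" for h :: "_ \<Rightarrow> real"
    proof -
      have h': "h \<in> borel_measurable (empirical \<xi>)"
        using h measurable_cong_sets[OF sets_empirical refl] by blast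
      show "integrable \<pi> (\<lambda>z. h (snd z))"
        using integrable_empirical[of \<xi>, OF \<xi> h] integrable_distr_eq[OF snd_meas h'] dQ by simp
      show "(\<integral>z. h (snd z) \<partial>\<pi>) = (\<Sum>i\<in>UNIV. h (\<xi> i)) / CARD('n)"
        using integral_empirical[of \<xi>, OF \<xi> h] integral_distr[OF snd_meas h'] dQ by simp
    qed
    have f_P: "f \<in> borel_measurable P"
      using f_meas measurable_cong_sets[OF P_sets refl] by blast
    \<comment> \<open>The loss has linear growth, and the first moment of \<open>P\<close> is controlled by that of the
      empirical distribution and the transport cost.\<close>
    have bound: "\<bar>f (fst z)\<bar> \<le> \<bar>g 0\<bar> + M * dual_norm N w * N (fst (snd z)) +
        M * dual_norm N w * cost N \<kappa> (fst z) (snd z)" if z: "z \<in> space \<pi>" for z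
    proof -
      obtain a b a' b' where eq: "z = ((a, b), (a', b'))" by (cases z) auto
      have "\<bar>b\<bar> = 1" using sp(1)[OF z] by (auto simp: eq space_Theta)
      then have "\<bar>b * (a \<bullet> w)\<bar> \<le> N a * dual_norm N w"
        using abs_inner_le_dual_norm[OF N, of a w] by (simp add: abs_mult)
      also have "0 \<le> \<kappa> * \<bar>b - b'\<bar>" using \<kappa> by simp
      then have "N a \<le> N a' + cost N \<kappa> (a, b) (a', b')"
        using is_norm_triangle[OF N, of "a - a'" a'] by (simp add: cost_def)
      finally have "\<bar>b * (a \<bullet> w)\<bar> \<le> (N a' + cost N \<kappa> (a, b) (a', b')) * dual_norm N w"
        using dual_norm_nonneg[OF N] by (simp add: mult_right_mono)
      then have "M * \<bar>b * (a \<bullet> w)\<bar> \<le> M * ((N a' + cost N \<kappa> (a, b) (a', b')) * dual_norm N w)"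
        using M by (rule mult_left_mono)
      moreover have "\<bar>g (b * (a \<bullet> w))\<bar> \<le> \<bar>g 0\<bar> + M * \<bar>b * (a \<bullet> w)\<bar>"
        using lip[of "b * (a \<bullet> w)" 0] lip[of 0 "b * (a \<bullet> w)"] by simp
      ultimately show ?thesis by (simp add: eq f_def algebra_simps)
    qed
    have int_f: "integrable \<pi> (\<lambda>z. f (fst z))"
    proof (rule Bochner_Integration.integrable_bound)
      show "integrable \<pi> (\<lambda>z. \<bar>g 0\<bar> + M * dual_norm N w * N (fst (snd z)) +
          M * dual_norm N w * cost N \<kappa> (fst z) (snd z))"
        by (intro Bochner_Integration.integrable_add integrable_mult_right int_c
            int_snd[of "\<lambda>z. N (fst z)"] norm_fst_measurable[OF N]) simp
      show "(\<lambda>z. f (fst z)) \<in> borel_measurable \<pi>" by (rule measurable_compose[OF fst_meas f_P])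
      show "AE z in \<pi>. norm (f (fst z)) \<le> norm (\<bar>g 0\<bar> + M * dual_norm N w * N (fst (snd z)) +
          M * dual_norm N w * cost N \<kappa> (fst z) (snd z))"
        by (rule AE_I2) (use bound in force)
    qed
    have "expected_loss g w P = (\<integral>z. f (fst z) \<partial>\<pi>)"
      using integral_distr[OF fst_meas f_P] dP
      by (simp add: expected_loss_def f_def[abs_def] case_prod_unfold)
    also have "\<dots> \<le> (\<integral>z. l * cost N \<kappa> (fst z) (snd z) + S (snd z) \<partial>\<pi>)"
    proof (rule integral_mono[OF int_f])
      show "integrable \<pi> (\<lambda>z. l * cost N \<kappa> (fst z) (snd z) + S (snd z))"
        by (intro Bochner_Integration.integrable_add integrable_mult_right int_c int_snd S_meas)
      show "f (fst z) \<le> l * cost N \<kappa> (fst z) (snd z) + S (snd z)" if "z \<in> space \<pi>" for z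
        unfolding f_def S_def by (rule loss_le_transport_cost[OF N M lip l sp[OF that]])
    qed
    also have "\<dots> = l * (\<integral>z. cost N \<kappa> (fst z) (snd z) \<partial>\<pi>) + (\<Sum>i\<in>UNIV. S (\<xi> i)) / CARD('n)"
      using int_c int_snd[OF S_meas] integral_snd[OF S_meas] by simp
    also have "\<dots> \<le> l * (\<rho> + \<delta>) + (\<Sum>i\<in>UNIV. S (\<xi> i)) / CARD('n)"
      using mult_left_mono[OF c_le \<open>l \<ge> 0\<close>] by simp
    also have "\<dots> \<le> \<rho> * l + (\<Sum>i\<in>UNIV. S (\<xi> i)) / CARD('n) + e"
      using \<delta>(2) by (simp add: algebra_simps)
    finally show ?thesis .
  qed
  then show ?thesis unfolding S_def by (rule field_le_epsilon)
qed

section \<open>Distributions obtained by relocating samples\<close>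

text \<open>Draw \<open>\<omega>\<close> from a finitely supported distribution under which \<open>j \<omega>\<close> is a uniform sample index,
  and move that sample to \<open>X \<omega>\<close>. The joint law of new and old position is a coupling, so its
  expected cost bounds the Wasserstein distance.\<close>
lemma relocation_in_ambiguity_set:
  fixes \<xi> :: "'n::finite \<Rightarrow> 'a::euclidean_space \<times> real" and p :: "'k pmf"
  assumes N: "is_norm N" and \<kappa>: "\<kappa> > 0"
    and \<xi>: "\<And>i. \<xi> i \<in> space Theta" and X: "\<And>\<omega>. X \<omega> \<in> space Theta"
    and fin: "finite (set_pmf p)" and j: "map_pmf j p = pmf_of_set UNIV"
    and budget: "measure_pmf.expectation p (\<lambda>\<omega>. cost N \<kappa> (X \<omega>) (\<xi> (j \<omega>))) \<le> \<rho>"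
  shows "distr (measure_pmf p) Theta X \<in> ambiguity_set N \<kappa> \<rho> \<xi>"
proof -
  define P where "P = distr (measure_pmf p) Theta X"
  define \<pi> where "\<pi> = distr (measure_pmf p) (Theta \<Otimes>\<^sub>M Theta) (\<lambda>\<omega>. (X \<omega>, \<xi> (j \<omega>)))"
  have X_meas: "X \<in> measurable (measure_pmf p) Theta" using X by simp
  have pair_meas: "(\<lambda>\<omega>. (X \<omega>, \<xi> (j \<omega>))) \<in> measurable (measure_pmf p) (Theta \<Otimes>\<^sub>M Theta)"
    using X \<xi> by (simp add: space_pair_measure)
  have emp: "empirical \<xi> = distr (measure_pmf p) Theta (\<lambda>\<omega>. \<xi> (j \<omega>))"
  proof -
    have "empirical \<xi> = distr (distr (measure_pmf p) (count_space UNIV) j) Theta \<xi>"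
      unfolding empirical_eq_distr[of \<xi>, OF \<xi>] j[symmetric] map_pmf_rep_eq ..
    also have "\<dots> = distr (measure_pmf p) Theta (\<xi> \<circ> j)"
      by (rule distr_distr) (use \<xi> in auto)
    finally show ?thesis by (simp add: comp_def)
  qed
  have prob_P: "prob_space P" unfolding P_def by (rule measure_pmf.prob_space_distr[OF X_meas])
  have sets_P: "sets P = sets Theta" unfolding P_def by simp
  have "\<pi> \<in> couplings P (empirical \<xi>)"
  proof -
    have "distr \<pi> P fst = distr \<pi> Theta fst" by (rule distr_cong) (auto simp: sets_P)
    also have "\<dots> = P"
      unfolding \<pi>_def P_def by (subst distr_distr[OF measurable_fst pair_meas]) (simp add: comp_def)
    finally have "distr \<pi> P fst = P" .
    moreover have "distr \<pi> (empirical \<xi>) snd = distr \<pi> Theta snd" by (rule distr_cong) auto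
    then have "distr \<pi> (empirical \<xi>) snd = empirical \<xi>"
      unfolding \<pi>_def emp by (subst (asm) distr_distr[OF measurable_snd pair_meas]) (simp add: comp_def)
    moreover have "prob_space \<pi>" unfolding \<pi>_def by (rule measure_pmf.prob_space_distr[OF pair_meas])
    moreover have "sets \<pi> = sets (P \<Otimes>\<^sub>M empirical \<xi>)"
      unfolding \<pi>_def using sets_pair_measure_cong[OF sets_P sets_empirical, symmetric] by simp
    ultimately show ?thesis by (simp add: couplings_def)
  qed
  then have "wasserstein (cost N \<kappa>) P (empirical \<xi>)
      \<le> (\<integral>\<^sup>+ z. ennreal (cost N \<kappa> (fst z) (snd z)) \<partial>\<pi>)"
    unfolding wasserstein_def by (rule INF_lower)
  also have "\<dots> = (\<integral>\<^sup>+ \<omega>. ennreal (cost N \<kappa> (X \<omega>) (\<xi> (j \<omega>))) \<partial>measure_pmf p)"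
    unfolding \<pi>_def using cost_measurable[OF N] by (subst nn_integral_distr[OF pair_meas]) auto
  also have "\<dots> = ennreal (measure_pmf.expectation p (\<lambda>\<omega>. cost N \<kappa> (X \<omega>) (\<xi> (j \<omega>))))"
    by (rule nn_integral_eq_integral)
      (use integrable_measure_pmf_finite[OF fin] cost_nonneg[OF N \<kappa>] in auto)
  also have "\<dots> \<le> ennreal \<rho>" using budget by (rule ennreal_leI)
  finally show ?thesis using prob_P sets_P unfolding P_def by (simp add: ambiguity_set_def distributions_def)
qed

lemma expected_loss_relocation:
  fixes w :: "'a::euclidean_space" and p :: "'k pmf"
  assumes "continuous_on UNIV g" "\<And>\<omega>. X \<omega> \<in> space Theta"
  shows "expected_loss g w (distr (measure_pmf p) Theta X) =
    measure_pmf.expectation p (\<lambda>\<omega>. g (snd (X \<omega>) * (fst (X \<omega>) \<bullet> w)))"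
  unfolding expected_loss_def case_prod_unfold
  by (subst integral_distr[OF _ loss_measurable[OF assms(1)]]) (use assms(2) in auto)

text \<open>The random relocation plan behind the worst case. The first decision flips the label of the
  sample, the second moves its feature vector far away. The two are independent given the sample,
  so that escapes scale the gain from all flips down by the same factor \<open>1 - \<epsilon>\<close>.\<close>
definition flip_escape :: "('n::finite \<Rightarrow> real) \<Rightarrow> real \<Rightarrow> ('n \<times> bool \<times> bool) pmf" where
  "flip_escape \<alpha> \<epsilon> = bind_pmf (pmf_of_set UNIV) (\<lambda>i. bind_pmf (bernoulli_pmf (\<alpha> i))
     (\<lambda>flip. map_pmf (\<lambda>escape. (i, flip, escape)) (bernoulli_pmf \<epsilon>)))"

lemma map_fst_flip_escape: "map_pmf fst (flip_escape \<alpha> \<epsilon>) = pmf_of_set UNIV"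
  by (simp add: flip_escape_def map_bind_pmf map_pmf_comp map_pmf_const bind_return_pmf')

lemma expectation_flip_escape:
  fixes \<alpha> :: "'n::finite \<Rightarrow> real" and h :: "_ \<Rightarrow> real"
  assumes "\<And>i. 0 \<le> \<alpha> i" "\<And>i. \<alpha> i \<le> 1" "0 \<le> \<epsilon>" "\<epsilon> \<le> 1"
  shows "measure_pmf.expectation (flip_escape \<alpha> \<epsilon>) h = (\<Sum>i\<in>UNIV.
    \<alpha> i * (\<epsilon> * h (i, True, True) + (1 - \<epsilon>) * h (i, True, False)) +
    (1 - \<alpha> i) * (\<epsilon> * h (i, False, True) + (1 - \<epsilon>) * h (i, False, False))) / CARD('n)"
proof -
  have eq: "measure_pmf.expectation (bernoulli_pmf (\<alpha> i) \<bind>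
      (\<lambda>flip. map_pmf (\<lambda>escape. (i, flip, escape)) (bernoulli_pmf \<epsilon>))) h =
    \<alpha> i * (\<epsilon> * h (i, True, True) + (1 - \<epsilon>) * h (i, True, False)) +
    (1 - \<alpha> i) * (\<epsilon> * h (i, False, True) + (1 - \<epsilon>) * h (i, False, False))" for i
    using assms by (subst pmf_expectation_bind[of UNIV]) (auto simp: UNIV_bool algebra_simps)
  show ?thesis
    unfolding flip_escape_def
    by (subst pmf_expectation_bind_pmf_of_set)
      (simp_all add: eq divide_inverse_commute sum_distrib_left[symmetric])
qed

section \<open>Worst-case distributions\<close>

text \<open>A budget \<open>r\<close> left over after the flips still buys an expected loss of \<open>\<bar>\<theta>\<bar> * r * (e \<bullet> w)\<close> for every
  slope \<open>\<theta>\<close> of a line below \<open>g\<close>. Mass \<open>\<epsilon>\<close> is moved by \<open>r / \<epsilon>\<close> times \<open>\<plusminus>e\<close>, the sign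
  being chosen so that \<open>b * (a \<bullet> w)\<close> escapes in the direction in which that line rises. This costs
  at most \<open>r\<close> for every \<open>\<epsilon>\<close>, while the offset of the line and the loss given up at the original
  positions are weighted with \<open>\<epsilon>\<close> and disappear in the limit. In general no single
  distribution reaches the supremum, hence the formulation with an upper bound \<open>B\<close>.\<close>
lemma escape_le_expected_loss_bound:
  fixes g :: "real \<Rightarrow> real" and w e :: "'a::euclidean_space"
    and a :: "'n::finite \<Rightarrow> 'a" and b :: "'n \<Rightarrow> real"
  assumes N: "is_norm N" and \<kappa>: "\<kappa> > 0" and g: "continuous_on UNIV g"
    and b: "\<And>i. b i \<in> {1, -1}"
    and \<theta>: "\<And>x. \<theta> * x - c \<le> g x" and e: "N e \<le> 1"
    and \<alpha>: "\<And>i. 0 \<le> \<alpha> i" "\<And>i. \<alpha> i \<le> 1" and r: "r \<ge> 0"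
    and budget: "2 * \<kappa> * (\<Sum>i\<in>UNIV. \<alpha> i) / CARD('n) + r \<le> \<rho>"
    and B: "\<And>P. P \<in> ambiguity_set N \<kappa> \<rho> (\<lambda>i. (a i, b i)) \<Longrightarrow> expected_loss g w P \<le> B"
  shows "(\<Sum>i\<in>UNIV. (1 - \<alpha> i) * g (b i * (a i \<bullet> w)) + \<alpha> i * g (- (b i * (a i \<bullet> w)))) / CARD('n)
     + \<bar>\<theta>\<bar> * r * (e \<bullet> w) \<le> B"
proof -
  define V where "V = (\<Sum>i\<in>UNIV. (1 - \<alpha> i) * g (b i * (a i \<bullet> w)) + \<alpha> i * g (- (b i * (a i \<bullet> w)))) / CARD('n)"
  \<comment> \<open>An escape starts from \<open>a i\<close> with either label, not from the origin; \<open>C\<close> covers the intercept of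
    the line and the worst of these starting points.\<close>
  define C where "C = c + \<bar>\<theta>\<bar> * (\<Sum>i\<in>UNIV. \<bar>a i \<bullet> w\<bar>)"
  define b' where "b' i f = (if f then - b i else b i)" for i f
  have abs_b: "\<bar>b i\<bar> = 1" for i using b[of i] by auto
  have b'_abs: "\<bar>b' i f\<bar> = 1" for i f using abs_b[of i] by (auto simp: b'_def)
  have b'_sq: "b' i f * b' i f = 1" for i f using b'_abs[of i f] by (metis abs_mult_self_eq mult_1)
  have main: "(1 - \<epsilon>) * V + \<bar>\<theta>\<bar> * r * (e \<bullet> w) - \<epsilon> * C \<le> B" if \<epsilon>: "0 < \<epsilon>" "\<epsilon> \<le> 1" for \<epsilon>
  proof -
    define K where "K = r / \<epsilon>"
    have K: "K \<ge> 0" "\<epsilon> * K = r" using r \<epsilon> by (auto simp: K_def)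
    define X where "X = (\<lambda>(i, f, k). (a i + (if k then (b' i f * sgn \<theta> * K) *\<^sub>R e else 0), b' i f))"
    define p where "p = flip_escape \<alpha> \<epsilon>"
    have fin: "finite (set_pmf p)" by simp
    have X_Theta: "X \<omega> \<in> space Theta" for \<omega>
      using b by (auto simp: X_def b'_def space_Theta split: prod.splits)
    have cost_le: "cost N \<kappa> (X (i, f, k)) (a i, b i) \<le> of_bool k * K + of_bool f * (2 * \<kappa>)" for i f k
    proof -
      have "N ((b' i f * sgn \<theta> * K) *\<^sub>R e) = \<bar>sgn \<theta>\<bar> * (K * N e)"
        using K b'_abs by (simp add: is_norm_scaleR[OF N] abs_mult)
      also have "\<dots> \<le> 1 * (K * 1)"
        using K e is_norm_nonneg[OF N, of e] by (intro mult_mono) (auto simp: sgn_real_def)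
      finally have "N ((b' i f * sgn \<theta> * K) *\<^sub>R e) \<le> K" by simp
      moreover have "N 0 = 0" using is_norm_eq_0_iff[OF N] by simp
      moreover have "\<bar>b' i f - b i\<bar> = of_bool f * 2" using b[of i] by (auto simp: b'_def)
      ultimately show ?thesis by (auto simp: X_def cost_def)
    qed
    have "measure_pmf.expectation p (\<lambda>\<omega>. cost N \<kappa> (X \<omega>) (a (fst \<omega>), b (fst \<omega>)))
        \<le> measure_pmf.expectation p (\<lambda>(i, f, k). of_bool k * K + of_bool f * (2 * \<kappa>))"
      by (intro integral_mono integrable_measure_pmf_finite fin)
        (use cost_le in \<open>auto split: prod.splits\<close>)
    also have "\<dots> = (\<Sum>i\<in>UNIV. r + 2 * \<kappa> * \<alpha> i) / CARD('n)"
      unfolding p_def using \<epsilon> \<alpha>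
      by (subst expectation_flip_escape) (auto simp: K(2)[symmetric] algebra_simps)
    also have "\<dots> = 2 * \<kappa> * (\<Sum>i\<in>UNIV. \<alpha> i) / CARD('n) + r"
      by (simp add: sum.distrib sum_distrib_left[symmetric] add_divide_distrib)
    also note budget
    finally have "distr (measure_pmf p) Theta X \<in> ambiguity_set N \<kappa> \<rho> (\<lambda>i. (a i, b i))"
      using b by (intro relocation_in_ambiguity_set[OF N \<kappa> _ X_Theta fin, where j = fst])
        (auto simp: p_def map_fst_flip_escape space_Theta)
    from B[OF this] have "measure_pmf.expectation p (\<lambda>\<omega>. g (snd (X \<omega>) * (fst (X \<omega>) \<bullet> w))) \<le> B"
      by (simp add: expected_loss_relocation[OF g X_Theta])
    moreover have "(1 - \<epsilon>) * V + \<bar>\<theta>\<bar> * r * (e \<bullet> w) - \<epsilon> * C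
        \<le> measure_pmf.expectation p (\<lambda>\<omega>. g (snd (X \<omega>) * (fst (X \<omega>) \<bullet> w)))"
    proof -
      define L where "L = (\<lambda>(i, f, k). if k then \<bar>\<theta>\<bar> * K * (e \<bullet> w) - C
         else g ((if f then -1 else 1) * (b i * (a i \<bullet> w))))"
      have "L (i, f, k) \<le> g (snd (X (i, f, k)) * (fst (X (i, f, k)) \<bullet> w))" for i f k
      proof (cases k)
        case True
        have "snd (X (i, f, k)) * (fst (X (i, f, k)) \<bullet> w)
            = b' i f * (a i \<bullet> w) + (b' i f * b' i f) * (sgn \<theta> * K * (e \<bullet> w))"
          using True by (simp add: X_def inner_add_left algebra_simps)
        also have "\<dots> = b' i f * (a i \<bullet> w) + sgn \<theta> * K * (e \<bullet> w)" by (simp add: b'_sq)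
        finally have eq: "snd (X (i, f, k)) * (fst (X (i, f, k)) \<bullet> w) = \<dots>" .
        have "\<bar>\<theta>\<bar> * \<bar>b' i f * (a i \<bullet> w)\<bar> \<le> \<bar>\<theta>\<bar> * (\<Sum>i\<in>UNIV. \<bar>a i \<bullet> w\<bar>)"
          by (intro mult_left_mono) (auto simp: abs_mult b'_abs intro: member_le_sum)
        moreover have "- (\<theta> * (b' i f * (a i \<bullet> w))) \<le> \<bar>\<theta>\<bar> * \<bar>b' i f * (a i \<bullet> w)\<bar>"
          by (metis abs_ge_minus_self abs_mult)
        moreover have "\<theta> * (b' i f * (a i \<bullet> w) + sgn \<theta> * K * (e \<bullet> w))
            = \<theta> * (b' i f * (a i \<bullet> w)) + \<bar>\<theta>\<bar> * K * (e \<bullet> w)"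
          by (simp add: distrib_left sgn_real_def)
        moreover have "L (i, f, k) = \<bar>\<theta>\<bar> * K * (e \<bullet> w) - (c + \<bar>\<theta>\<bar> * (\<Sum>i\<in>UNIV. \<bar>a i \<bullet> w\<bar>))"
          using True by (simp add: L_def C_def)
        ultimately have "L (i, f, k) \<le> \<theta> * (b' i f * (a i \<bullet> w) + sgn \<theta> * K * (e \<bullet> w)) - c"
          by linarith
        then show ?thesis unfolding eq by (rule order_trans[OF _ \<theta>])
      next
        case False
        then show ?thesis by (auto simp: L_def X_def b'_def)
      qed
      then have "measure_pmf.expectation p L
          \<le> measure_pmf.expectation p (\<lambda>\<omega>. g (snd (X \<omega>) * (fst (X \<omega>) \<bullet> w)))"
        by (intro integral_mono integrable_measure_pmf_finite fin) (metis prod.collapse)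
      moreover have "measure_pmf.expectation p L = (\<Sum>i\<in>UNIV. (1 - \<epsilon>) * ((1 - \<alpha> i) * g (b i * (a i \<bullet> w)) +
           \<alpha> i * g (- (b i * (a i \<bullet> w)))) + \<epsilon> * (\<bar>\<theta>\<bar> * K * (e \<bullet> w) - C)) / CARD('n)"
        unfolding p_def using \<epsilon> \<alpha>
        by (subst expectation_flip_escape) (auto simp: L_def algebra_simps)
      moreover have "\<dots> = (1 - \<epsilon>) * V + \<epsilon> * (\<bar>\<theta>\<bar> * K * (e \<bullet> w) - C)"
        unfolding V_def by (simp add: sum.distrib sum_distrib_left[symmetric] add_divide_distrib distrib_left)
      moreover have "\<dots> = (1 - \<epsilon>) * V + \<bar>\<theta>\<bar> * (\<epsilon> * K) * (e \<bullet> w) - \<epsilon> * C"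
        by (simp add: algebra_simps)
      ultimately show ?thesis by (simp only: K(2))
    qed
    ultimately show ?thesis by linarith
  qed
  have "V + \<bar>\<theta>\<bar> * r * (e \<bullet> w) \<le> B"
  proof (rule field_le_epsilon)
    fix d :: real assume d: "d > 0"
    define \<epsilon> where "\<epsilon> = min 1 (d / (\<bar>V + C\<bar> + 1))"
    have \<epsilon>: "0 < \<epsilon>" "\<epsilon> \<le> 1" using d by (auto simp: \<epsilon>_def)
    have "\<epsilon> * (V + C) \<le> \<epsilon> * (\<bar>V + C\<bar> + 1)" using \<epsilon> by (intro mult_left_mono) auto
    also have "\<dots> \<le> d / (\<bar>V + C\<bar> + 1) * (\<bar>V + C\<bar> + 1)"
      by (intro mult_right_mono) (auto simp: \<epsilon>_def)
    also have "\<dots> = d" by simp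
    finally show "V + \<bar>\<theta>\<bar> * r * (e \<bullet> w) \<le> B + d" using main[OF \<epsilon>] by (simp add: algebra_simps)
  qed
  then show ?thesis by (simp add: V_def)
qed

text \<open>Strong duality for fixed \<open>w\<close>. Spending the budget on flips is a fractional knapsack: flipping
  the label of sample \<open>i\<close> yields \<open>D i\<close> per unit of transport cost, and leftover budget yields
  \<open>M * dual_norm N w\<close> per unit by escaping to infinity. The optimal marginal price is the dual
  variable \<open>l\<close>, and \<open>h\<close> is the budget measured in flipped samples.\<close>
lemma dual_bound_attained:
  fixes g :: "real \<Rightarrow> real" and w :: "'a::euclidean_space"
    and a :: "'n::finite \<Rightarrow> 'a" and b :: "'n \<Rightarrow> real"
  assumes N: "is_norm N" and \<kappa>: "\<kappa> > 0" and \<rho>: "\<rho> \<ge> 0" and g: "convex_on UNIV g"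
    and b: "\<And>i. b i \<in> {1, -1}"
    and M: "M \<ge> 0" and M_Sup: "ereal M = (SUP \<theta>\<in>conjugate_dom g. ereal \<bar>\<theta>\<bar>)"
  obtains l where "M * dual_norm N w \<le> l"
    "ereal (\<rho> * l + (\<Sum>i\<in>UNIV. max (g (b i * (a i \<bullet> w)))
        (g (- (b i * (a i \<bullet> w))) - 2 * \<kappa> * l)) / CARD('n))
      \<le> (SUP P\<in>ambiguity_set N \<kappa> \<rho> (\<lambda>i. (a i, b i)). ereal (expected_loss g w P))"
proof -
  define u where "u i = b i * (a i \<bullet> w)" for i
  define D where "D i = (g (- u i) - g (u i)) / (2 * \<kappa>)" for i
  define n where "n = real CARD('n)"
  define h where "h = \<rho> * n / (2 * \<kappa>)"
  have n: "n > 0" by (simp add: n_def)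
  have h: "h \<ge> 0" using \<rho> \<kappa> n by (simp add: h_def)
  obtain l \<alpha> where l: "l \<ge> M * dual_norm N w"
    and \<alpha>: "\<And>i. 0 \<le> \<alpha> i" "\<And>i. \<alpha> i \<le> 1" and \<alpha>_sum: "(\<Sum>i\<in>UNIV. \<alpha> i) \<le> h"
    and opt: "(\<Sum>i\<in>UNIV. \<alpha> i * D i) + M * dual_norm N w * (h - (\<Sum>i\<in>UNIV. \<alpha> i))
      = l * h + (\<Sum>i\<in>UNIV. max 0 (D i - l))"
    using fractional_knapsack_threshold[OF h, of "M * dual_norm N w" D] by blast
  define r where "r = \<rho> - 2 * \<kappa> * (\<Sum>i\<in>UNIV. \<alpha> i) / n"
  have r_eq: "r = 2 * \<kappa> / n * (h - (\<Sum>i\<in>UNIV. \<alpha> i))"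
    using \<kappa> n by (simp add: r_def h_def field_simps)
  have r: "r \<ge> 0" unfolding r_eq using \<kappa> n \<alpha>_sum by simp
  define V where "V = (\<Sum>i\<in>UNIV. (1 - \<alpha> i) * g (u i) + \<alpha> i * g (- u i)) / n"
  have D_eq: "g (- u i) = g (u i) + 2 * \<kappa> * D i" for i using \<kappa> by (simp add: D_def)
  have max_eq: "max (g (u i)) (g (- u i) - 2 * \<kappa> * l) = g (u i) + 2 * \<kappa> * max 0 (D i - l)" for i
  proof -
    have "2 * \<kappa> * max 0 (D i - l) = max 0 (2 * \<kappa> * (D i - l))"
      using \<kappa> by (auto simp: max_def mult_le_0_iff zero_le_mult_iff)
    then show ?thesis unfolding D_eq by (simp add: max_def algebra_simps)
  qed
  have "(1 - \<alpha> i) * g (u i) + \<alpha> i * g (- u i) = g (u i) + 2 * \<kappa> * (\<alpha> i * D i)" for i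
    by (simp add: D_eq algebra_simps)
  then have V_eq: "V = ((\<Sum>i\<in>UNIV. g (u i)) + 2 * \<kappa> * (\<Sum>i\<in>UNIV. \<alpha> i * D i)) / n"
    unfolding V_def by (simp only: sum.distrib sum_distrib_left[symmetric])
  have "V + M * dual_norm N w * r = (\<Sum>i\<in>UNIV. g (u i)) / n +
      2 * \<kappa> / n * ((\<Sum>i\<in>UNIV. \<alpha> i * D i) + M * dual_norm N w * (h - (\<Sum>i\<in>UNIV. \<alpha> i)))"
    unfolding V_eq r_eq using n by (simp add: field_simps)
  also have "\<dots> = (\<Sum>i\<in>UNIV. g (u i)) / n + 2 * \<kappa> / n * (l * h + (\<Sum>i\<in>UNIV. max 0 (D i - l)))"
    by (simp only: opt)
  also have "\<dots> = \<rho> * l + (\<Sum>i\<in>UNIV. max (g (u i)) (g (- u i) - 2 * \<kappa> * l)) / n"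
    unfolding max_eq using \<kappa> n
    by (simp add: h_def sum.distrib sum_distrib_left[symmetric] add_divide_distrib distrib_left)
  finally have value_eq: "V + M * dual_norm N w * r = \<dots>" .
  have value_le: "V + M * dual_norm N w * r \<le> B"
    if B: "\<And>P. P \<in> ambiguity_set N \<kappa> \<rho> (\<lambda>i. (a i, b i)) \<Longrightarrow> expected_loss g w P \<le> B" for B
  proof -
    have g_cont: "continuous_on UNIV g" using convex_on_continuous[OF open_UNIV g] .
    have bound: "V + \<bar>\<theta>\<bar> * r * (e \<bullet> w) \<le> B" if \<theta>: "\<theta> \<in> conjugate_dom g" and e: "N e \<le> 1" for \<theta> e
    proof -
      obtain c where "\<And>x. \<theta> * x - c \<le> g x" using \<theta> unfolding conjugate_dom_iff by blast
      moreover have "2 * \<kappa> * (\<Sum>i\<in>UNIV. \<alpha> i) / CARD('n) + r \<le> \<rho>" by (simp add: r_def n_def)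
      ultimately show ?thesis unfolding V_def u_def n_def
        by (intro escape_le_expected_loss_bound[OF N \<kappa> g_cont b _ e \<alpha> r _ B])
    qed
    obtain \<theta> where "\<theta> \<in> conjugate_dom g" using convex_subgradient[OF g] by blast
    from bound[OF this, of 0] have "V \<le> B" using is_norm_eq_0_iff[OF N, of 0] by simp
    \<comment> \<open>The suprema defining \<open>M\<close> and the dual norm need not be attained, so the bound is carried
      over to each of them in turn; a factor that vanishes leaves only the bound on \<open>V\<close>.\<close>
    have slope: "M * r * (e \<bullet> w) \<le> B - V" if e: "N e \<le> 1" for e
    proof (cases "r * (e \<bullet> w) > 0")
      case True
      have "M \<le> (B - V) / (r * (e \<bullet> w))"
        by (rule Sup_conjugate_dom_least[OF M_Sup])
          (use bound[OF _ e] True in \<open>simp add: pos_le_divide_eq algebra_simps\<close>)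
      then show ?thesis using True by (simp add: pos_le_divide_eq mult.assoc)
    next
      case False
      then have "M * (r * (e \<bullet> w)) \<le> 0" by (intro mult_nonneg_nonpos[OF M]) simp
      then show ?thesis using \<open>V \<le> B\<close> by (simp add: mult.assoc)
    qed
    have "M * r * dual_norm N w \<le> B - V"
    proof (cases "M * r > 0")
      case True
      have "dual_norm N w \<le> (B - V) / (M * r)"
        by (rule dual_norm_le[OF N]) (use slope True in \<open>simp add: pos_le_divide_eq mult.commute\<close>)
      then show ?thesis using True by (simp add: pos_le_divide_eq mult.commute)
    next
      case False
      then have "M * r = 0" using M r mult_nonneg_nonneg[of M r] by linarith
      show ?thesis unfolding \<open>M * r = 0\<close> using \<open>V \<le> B\<close> by simp
    qed
    then show ?thesis by (simp add: mult_ac)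
  qed
  have "ereal (V + M * dual_norm N w * r)
      \<le> (SUP P\<in>ambiguity_set N \<kappa> \<rho> (\<lambda>i. (a i, b i)). ereal (expected_loss g w P))"
    by (rule ereal_le_real) (use value_le in \<open>simp add: SUP_le_iff\<close>)
  then show ?thesis using that[OF l] unfolding value_eq u_def n_def by blast
qed

section \<open>Reformulation as a finite convex program\<close>

theorem theorem4:
  fixes g :: "real \<Rightarrow> real"
    and M \<kappa> \<rho> :: real
    and nrm :: "real ^ 'd \<Rightarrow> real"
    and a :: "'n::finite \<Rightarrow> real ^ 'd"
    and b :: "'n \<Rightarrow> real"
  assumes "convex_on UNIV g"
    and "ereal M = (SUP \<theta>\<in>conjugate_dom g. ereal \<bar>\<theta>\<bar>)"
    and "M > 0"
    and "is_norm nrm"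
    and "\<kappa> > 0"
    and "\<rho> \<ge> 0"
    and "\<And>i. b i \<in> {1, -1}"
  shows "(INF w. SUP P\<in>ambiguity_set nrm \<kappa> \<rho> (\<lambda>i. (a i, b i)). ereal (expected_loss g w P)) =
         Inf {ereal (\<rho> * l + (1 / real CARD('n)) * (\<Sum>i\<in>UNIV. s $ i)) |
                (w :: real ^ 'd) (l :: real) (u :: real ^ 'n) (v :: real ^ 'n)
                (s :: real ^ 'n) (t :: real ^ 'n).
              (\<forall>i. u $ i = b i * (a i \<bullet> w)) \<and>
              (\<forall>i. v $ i = - (u $ i)) \<and>
              (\<forall>i. t $ i = 2 * \<kappa> * l + s $ i) \<and>
              (\<forall>i. g (u $ i) \<le> s $ i) \<and>
              (\<forall>i. g (v $ i) \<le> t $ i) \<and>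
              dual_norm nrm w \<le> l / M}"
    (is "?primal = Inf ?dual")
proof (rule antisym)
  show "?primal \<le> Inf ?dual"
  proof (rule Inf_greatest)
    fix x assume "x \<in> ?dual"
    then obtain w l and u v s t :: "real ^ 'n" where
      x: "x = ereal (\<rho> * l + (1 / real CARD('n)) * (\<Sum>i\<in>UNIV. s $ i))"
      and u: "\<And>i. u $ i = b i * (a i \<bullet> w)" and v: "\<And>i. v $ i = - (u $ i)"
      and t: "\<And>i. t $ i = 2 * \<kappa> * l + s $ i"
      and gu: "\<And>i. g (u $ i) \<le> s $ i" and gv: "\<And>i. g (v $ i) \<le> t $ i"
      and l: "dual_norm nrm w \<le> l / M"
      by blast
    have l': "M * dual_norm nrm w \<le> l" using l assms(3) by (simp add: pos_le_divide_eq mult.commute)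
    have "expected_loss g w P \<le> \<rho> * l + (1 / real CARD('n)) * (\<Sum>i\<in>UNIV. s $ i)"
      if P: "P \<in> ambiguity_set nrm \<kappa> \<rho> (\<lambda>i. (a i, b i))" for P
    proof -
      have "expected_loss g w P \<le> \<rho> * l + (\<Sum>i\<in>UNIV. max (g (b i * (a i \<bullet> w)))
           (g (- (b i * (a i \<bullet> w))) - 2 * \<kappa> * l)) / CARD('n)"
        using expected_loss_le_dual[OF assms(4,5,6) less_imp_le[OF assms(3)]
            convex_lipschitz_of_conjugate_dom[OF assms(1) Sup_conjugate_dom_upper[OF assms(2)]] l' _ P] assms(7)
        by (simp add: space_Theta)
      also have "\<dots> \<le> \<rho> * l + (\<Sum>i\<in>UNIV. s $ i) / CARD('n)"
      proof -
        have "max (g (b i * (a i \<bullet> w))) (g (- (b i * (a i \<bullet> w))) - 2 * \<kappa> * l) \<le> s $ i" for i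
          using gu[of i] gv[of i] by (simp add: u v t)
        then show ?thesis by (intro add_left_mono divide_right_mono sum_mono) auto
      qed
      finally show ?thesis by simp
    qed
    then have "(SUP P\<in>ambiguity_set nrm \<kappa> \<rho> (\<lambda>i. (a i, b i)). ereal (expected_loss g w P)) \<le> x"
      unfolding x by (intro SUP_least) simp
    then show "?primal \<le> x" by (rule INF_lower2[OF UNIV_I])
  qed
  show "Inf ?dual \<le> ?primal"
  proof (rule INF_greatest)
    fix w
    obtain l where l: "M * dual_norm nrm w \<le> l"
      and tight: "ereal (\<rho> * l + (\<Sum>i\<in>UNIV. max (g (b i * (a i \<bullet> w)))
          (g (- (b i * (a i \<bullet> w))) - 2 * \<kappa> * l)) / CARD('n))
        \<le> (SUP P\<in>ambiguity_set nrm \<kappa> \<rho> (\<lambda>i. (a i, b i)). ereal (expected_loss g w P))"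
      using dual_bound_attained[where a = a and b = b and w = w,
          OF assms(4,5,6,1,7) less_imp_le[OF assms(3)] assms(2)] by blast
    define s :: "real ^ 'n" where
      "s = (\<chi> i. max (g (b i * (a i \<bullet> w))) (g (- (b i * (a i \<bullet> w))) - 2 * \<kappa> * l))"
    have "ereal (\<rho> * l + (1 / real CARD('n)) * (\<Sum>i\<in>UNIV. s $ i)) \<in> ?dual"
    proof (intro CollectI exI conjI allI)
      show "(\<chi> i. b i * (a i \<bullet> w)) $ i = b i * (a i \<bullet> w)"
        "(\<chi> i. - (b i * (a i \<bullet> w))) $ i = - ((\<chi> i. b i * (a i \<bullet> w)) $ i)"
        "(\<chi> i. 2 * \<kappa> * l + s $ i) $ i = 2 * \<kappa> * l + s $ i"
        "g ((\<chi> i. b i * (a i \<bullet> w)) $ i) \<le> s $ i"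
        "g ((\<chi> i. - (b i * (a i \<bullet> w))) $ i) \<le> (\<chi> i. 2 * \<kappa> * l + s $ i) $ i" for i
        by (auto simp: s_def)
      show "dual_norm nrm w \<le> l / M" using l assms(3) by (simp add: pos_le_divide_eq mult.commute)
    qed (rule refl)
    moreover have "ereal (\<rho> * l + (1 / real CARD('n)) * (\<Sum>i\<in>UNIV. s $ i))
        \<le> (SUP P\<in>ambiguity_set nrm \<kappa> \<rho> (\<lambda>i. (a i, b i)). ereal (expected_loss g w P))"
      using tight by (simp add: s_def)
    ultimately show "Inf ?dual
        \<le> (SUP P\<in>ambiguity_set nrm \<kappa> \<rho> (\<lambda>i. (a i, b i)). ereal (expected_loss g w P))"
      by (rule Inf_lower2)
  qed
qed

end
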